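(* Let $x_1,\ldots,x_n$ be $n\ge 2$ pairwise distinct points in $\mathbb{R}^2$ and let $P_n=n^{-1}\sum_{k=1}^n\delta_{x_k}$. For $1\le i<j\le n$ let $b_{ij}=\frac{x_j-x_i}{\|x_j-x_i\|}\in\mathbb{S}_1$, let $b_{ij}'\in\mathbb{S}_1$ be orthogonal to $b_{ij}$, and let $U_{ij}\in\mathbb{O}(2)$ be the matrix with row vectors $b_{ij}^{t}$ and ${b_{ij}'}^{t}$. Let $\mathscr{L}(P_n)$ be the finite set of all pairs $(\theta_{ij},U_{ij})$ with $1\le i<j\le n$ and $\theta_{ij}=U_{ij}^{t}\eta$ for some $\eta\in\mathcal{M}\bigl(P_n^{U_{ij}}\bigr)$. Then there is an element $(\theta_{ij},U_{ij})\in\mathscr{L}(P_n)$ that solves the quarter median problem for $P_n$.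
   Context: Vectors are columns, $x^{t}$ denotes the transpose, $\langle x,y\rangle=x^{t}y$, $\|\cdot\|$ is the Euclidean norm, $\mathbb{S}_1$ is the unit circle in $\mathbb{R}^2$, $\mathbb{O}(2)$ is the group of orthogonal $2\times 2$ matrices, $\delta_x$ is unit mass at $x$. For $U\in\mathbb{O}(2)$, $P^U$ is the push-forward of $P$ under $x\mapsto Ux$; $P^{\pi_i}$ is the push-forward of $P$ under the $i$th coordinate projection, $i=1,2$. For a probability measure $Q$ on $\mathbb{R}$ let $\mathrm{Med}_-(Q)=\inf\{x:Q((-\infty,x])\ge 1/2\}$, $\mathrm{Med}_+(Q)=\sup\{x:Q([x,\infty))\ge 1/2\}$ and $\mathrm{Med}_m(Q)=(\mathrm{Med}_-(Q)+\mathrm{Med}_+(Q))/2$. For a probability measure $P$ on $\mathbb{R}^2$ let $$\mathcal{M}(P)=\prod_{i=1}^2\bigl\{\mathrm{Med}_-(P^{\pi_i}),\mathrm{Med}_m(P^{\pi_i}),\mathrm{Med}_+(P^{\pi_i})\bigr\}\subset\mathbb{R}^2.$$ For $a\in\mathbb{R}^2$ and $b\in\mathbb{S}_1$ let $H_-(a;b)=\{x:\langle b,x-a\rangle\le 0\}$ and $H_+(a;b)=\{x:\langle b,x-a\rangle\ge 0\}$. For orthogonal $b,b'\in\mathbb{S}_1$ and signs $\sigma,\sigma'\in\{+,-\}$ let $V_{\sigma\sigma'}(a;b,b')=H_\sigma(a;b)\cap H_{\sigma'}(a;b')$. A pair $(\theta,U)\in\mathbb{R}^2\times\mathbb{O}(2)$,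 where $U$ has rows $b_1^{t},b_2^{t}$, solves the quarter median problem for a probability measure $P$ on $\mathbb{R}^2$ if $P(H_\pm(\theta;b_i))\ge 1/2$ for $i=1,2$ and both signs, and $P(V_{\sigma\sigma'}(\theta;b_1,b_2))\ge 1/4$ for all four sign combinations. *)

theory Defs
  imports "HOL-Probability.Probability"
begin

definition empirical_measure :: "nat \<Rightarrow> (nat \<Rightarrow> real^2) \<Rightarrow> (real^2) measure" where
  "empirical_measure n x = measure_of UNIV (sets borel)
     (\<lambda>A. ennreal (1 / real n) * (\<Sum>k=1..n. emeasure (return borel (x k)) A))"

text \<open>\<^const>\<open>measure_of\<close> yields the zero measure for set functions that are not
  measures; the next lemmas show that this does not happen here.\<close>

lemma space_empirical_measure [simp]: "space (empirical_measure n x) = UNIV"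
  by (simp add: empirical_measure_def space_measure_of_conv)

lemma sets_empirical_measure [simp, measurable_cong]: "sets (empirical_measure n x) = sets borel"
  using sets.sigma_sets_eq[of "borel :: (real^2) measure"]
  by (simp add: empirical_measure_def sets_measure_of_conv)

lemma emeasure_empirical_measure:
  assumes "A \<in> sets borel"
  shows "emeasure (empirical_measure n x) A
    = ennreal (1 / real n) * (\<Sum>k=1..n. emeasure (return borel (x k)) A)"
proof (rule emeasure_measure_of[OF empirical_measure_def])
  show "countably_additive (sets (empirical_measure n x))
     (\<lambda>A. ennreal (1 / real n) * (\<Sum>k=1..n. emeasure (return borel (x k)) A))"
  proof (rule countably_additiveI)
    fix A :: "nat \<Rightarrow> (real^2) set"
    assume A: "range A \<subseteq> sets (empirical_measure n x)" "disjoint_family A"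
    have "(\<Sum>i. emeasure (return borel (x k)) (A i)) = emeasure (return borel (x k)) (\<Union>i. A i)" for k
      using A by (intro suminf_emeasure) auto
    then show "(\<Sum>i. ennreal (1 / real n) * (\<Sum>k=1..n. emeasure (return borel (x k)) (A i)))
      = ennreal (1 / real n) * (\<Sum>k=1..n. emeasure (return borel (x k)) (\<Union>i. A i))"
      by (simp add: ennreal_suminf_cmult suminf_sum)
  qed
qed (use assms in \<open>auto simp: positive_def\<close>)

lemma measure_empirical_measure:
  assumes "A \<in> sets borel"
  shows "measure (empirical_measure n x) A = real (card {k \<in> {1..n}. x k \<in> A}) / real n"
proof -
  have "(\<Sum>k=1..n. emeasure (return borel (x k)) A) = ennreal (real (card {k \<in> {1..n}. x k \<in> A}))"
    using assms by (simp add: indicator_def sum.If_cases Int_def ennreal_of_nat_eq_real_of_nat)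
  then show ?thesis
    using assms by (simp add: measure_def emeasure_empirical_measure flip: ennreal_mult')
qed

lemma prob_space_empirical_measure:
  assumes "n \<ge> 1"
  shows "prob_space (empirical_measure n x)"
proof
  have "emeasure (empirical_measure n x) UNIV = ennreal (1 / real n) * of_nat n"
    by (simp add: emeasure_empirical_measure)
  also have "\<dots> = 1"
    using assms by (simp add: ennreal_of_nat_eq_real_of_nat flip: ennreal_mult')
  finally show "emeasure (empirical_measure n x) (space (empirical_measure n x)) = 1"
    by simp
qed

definition med_lower :: "real measure \<Rightarrow> real" where
  "med_lower Q = Inf {x. measure Q {..x} \<ge> 1/2}"

definition med_upper :: "real measure \<Rightarrow> real" where
  "med_upper Q = Sup {x. measure Q {x..} \<ge> 1/2}"

definition med_mid :: "real measure \<Rightarrow> real" where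
  "med_mid Q = (med_lower Q + med_upper Q) / 2"

definition proj_measure :: "(real^2) measure \<Rightarrow> 2 \<Rightarrow> real measure" where
  "proj_measure P i = distr P borel (\<lambda>x. x $ i)"

definition rotate_measure :: "(real^2) measure \<Rightarrow> real^2^2 \<Rightarrow> (real^2) measure" where
  "rotate_measure P U = distr P borel (\<lambda>x. U *v x)"

definition med_grid :: "(real^2) measure \<Rightarrow> (real^2) set" where
  "med_grid P = {\<eta>. \<forall>i. \<eta> $ i \<in>
     {med_lower (proj_measure P i), med_mid (proj_measure P i), med_upper (proj_measure P i)}}"

datatype side = Neg | Pos

fun halfspace :: "side \<Rightarrow> real^2 \<Rightarrow> real^2 \<Rightarrow> (real^2) set" where
  "halfspace Neg a b = {x. b \<bullet> (x - a) \<le> 0}"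
| "halfspace Pos a b = {x. b \<bullet> (x - a) \<ge> 0}"

definition quadrant :: "side \<Rightarrow> side \<Rightarrow> real^2 \<Rightarrow> real^2 \<Rightarrow> real^2 \<Rightarrow> (real^2) set" where
  "quadrant s s' a b b' = halfspace s a b \<inter> halfspace s' a b'"

definition solves_quarter_median :: "(real^2) measure \<Rightarrow> (real^2) \<times> (real^2^2) \<Rightarrow> bool" where
  "solves_quarter_median P = (\<lambda>(\<theta>, U). orthogonal_matrix U \<and>
     (\<forall>i s. measure P (halfspace s \<theta> (row i U)) \<ge> 1/2) \<and>
     (\<forall>s s'. measure P (quadrant s s' \<theta> (row 1 U) (row 2 U)) \<ge> 1/4))"

definition pair_dir :: "(nat \<Rightarrow> real^2) \<Rightarrow> nat \<Rightarrow> nat \<Rightarrow> real^2" where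
  "pair_dir x i j = (x j - x i) /\<^sub>R norm (x j - x i)"

text \<open>The second row of the frame is only determined up to sign, so its choice
  \<^term>\<open>b' :: nat \<Rightarrow> nat \<Rightarrow> real^2\<close> is a parameter.\<close>

definition pair_frame :: "(nat \<Rightarrow> real^2) \<Rightarrow> (nat \<Rightarrow> nat \<Rightarrow> real^2) \<Rightarrow> nat \<Rightarrow> nat \<Rightarrow> real^2^2" where
  "pair_frame x b' i j = vector [pair_dir x i j, b' i j]"

definition candidates ::
    "nat \<Rightarrow> (nat \<Rightarrow> real^2) \<Rightarrow> (nat \<Rightarrow> nat \<Rightarrow> real^2) \<Rightarrow> ((real^2) \<times> (real^2^2)) set" where
  "candidates n x b' =
     {(transpose (pair_frame x b' i j) *v \<eta>, pair_frame x b' i j) | i j \<eta>.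
        1 \<le> i \<and> i < j \<and> j \<le> n \<and>
        \<eta> \<in> med_grid (rotate_measure (empirical_measure n x) (pair_frame x b' i j))}"

lemma row_pair_frame [simp]:
  "row 1 (pair_frame x b' i j) = pair_dir x i j"
  "row 2 (pair_frame x b' i j) = b' i j"
  by (simp_all add: pair_frame_def row_def vec_eq_iff)

lemma orthogonal_matrix_pair_frame:
  assumes "x i \<noteq> x j" "norm (b' i j) = 1" "pair_dir x i j \<bullet> b' i j = 0"
  shows "orthogonal_matrix (pair_frame x b' i j)"
proof -
  have "norm (pair_dir x i j) = 1"
    using assms(1) by (simp add: pair_dir_def)
  with assms(2,3) show ?thesis
    by (auto simp: orthogonal_matrix_orthonormal_rows forall_2 orthogonal_def inner_commute)
qed

lemma finite_med_grid: "finite (med_grid P)"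
proof (rule finite_subset)
  let ?S = "\<lambda>i. {med_lower (proj_measure P i), med_mid (proj_measure P i), med_upper (proj_measure P i)}"
  show "med_grid P \<subseteq> (\<lambda>(a, c). vector [a, c]) ` (?S 1 \<times> ?S 2)"
  proof
    fix \<eta> assume "\<eta> \<in> med_grid P"
    then have "(\<eta> $ 1, \<eta> $ 2) \<in> ?S 1 \<times> ?S 2"
      unfolding med_grid_def by blast
    moreover have "\<eta> = vector [\<eta> $ 1, \<eta> $ 2]"
      by (simp add: vec_eq_iff forall_2)
    ultimately show "\<eta> \<in> (\<lambda>(a, c). vector [a, c]) ` (?S 1 \<times> ?S 2)"
      by (metis (no_types, lifting) case_prod_conv rev_image_eqI)
  qed
qed simp

lemma finite_candidates: "finite (candidates n x b')"
proof -
  have "candidates n x b' \<subseteq> (\<Union>i\<in>{1..n}. \<Union>j\<in>{1..n}.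
     (\<lambda>\<eta>. (transpose (pair_frame x b' i j) *v \<eta>, pair_frame x b' i j)) `
       med_grid (rotate_measure (empirical_measure n x) (pair_frame x b' i j)))"
    unfolding candidates_def by fastforce
  then show ?thesis
    by (rule finite_subset) (simp add: finite_med_grid)
qed

end

theory Submission
  imports Defs
begin

text \<open>The midpoint median alone produces a solution. For a direction \<open>v\<close> in the plane
  consider the line orthogonal to \<open>v\<close> through the midpoint median of the projections
  \<open>v \<bullet> x k\<close>, and the closed half-plane that it bounds in direction \<open>v\<close>. This half-plane
  depends on \<open>v\<close> only, and always holds at least half of the points. For a unit vector \<open>v\<close>, the
  four closed quadrants of the frame \<open>v\<close>, \<open>J v\<close>, where \<open>J\<close> is the quarter turn, are the
  intersections of the half-planes of \<open>w\<close> and \<open>J w\<close> for \<open>w = v, J v, - v, - J v\<close>.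

  If one quadrant holds fewer than a quarter of the points, then each of its two neighbours holds
  more than a quarter, because together they cover a half-plane. So for every \<open>v\<close> one of the two
  diagonal pairs of quadrants consists of quadrants with at least a quarter of the points each.
  A quarter turn of \<open>v\<close> exchanges the two diagonals. Medians are continuous in the data and the
  half-planes are closed, so for each diagonal the set of good directions is closed; the two sets
  are nonempty and cover the unit circle, which is connected. Hence they meet, in a
  \<^emph>\<open>balanced\<close> direction (lemma \<open>balanced_exists\<close>).

  A balanced direction need not be parallel or orthogonal to the join of two points. But if
  it is not, then the projections of the points to \<open>v\<close> and to \<open>J v\<close> are pairwise distinct,
  their order is unchanged near \<open>v\<close>, and all directions near \<open>v\<close> are balanced as well
  (lemma \<open>eventually_balanced\<close>). If no join of two points gave a balanced direction, the
  balanced directions would thus form an open, closed and nonempty subset of the circle, hence the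
  whole circle, and the join of any two points would be balanced after all
  (lemma \<open>balanced_through_two_points\<close>).\<close>

section \<open>Medians of finite families of reals\<close>

definition lower_median :: "'a set \<Rightarrow> ('a \<Rightarrow> real) \<Rightarrow> real" where
  "lower_median A y = Inf {t. card A \<le> 2 * card {k\<in>A. y k \<le> t}}"

text \<open>The upper median is the negated lower median of the negated data, so facts about the
  lower median yield those about the upper one.\<close>

definition mid_median :: "'a set \<Rightarrow> ('a \<Rightarrow> real) \<Rightarrow> real" where
  "mid_median A y = (lower_median A y - lower_median A (\<lambda>k. - y k)) / 2"

lemma mid_median_uminus: "mid_median A (\<lambda>k. - y k) = - mid_median A y"
  by (simp add: mid_median_def field_simps)

text \<open>This adjunction contains all that is needed about the infimum in the definition. It holds
  because the infimum is attained: lowering a bound \<open>t\<close> to the largest value below it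
  changes no count, so only the finitely many values themselves matter.\<close>

lemma lower_median_le_iff:
  assumes "finite A" "A \<noteq> {}"
  shows "lower_median A y \<le> t \<longleftrightarrow> card A \<le> 2 * card {k\<in>A. y k \<le> t}"
proof -
  define T where "T = {t. card A \<le> 2 * card {k\<in>A. y k \<le> t}}"
  define m where "m = Min (T \<inter> y ` A)"
  have up: "t \<in> T" if "s \<in> T" "s \<le> t" for s t
  proof -
    have "card {k\<in>A. y k \<le> s} \<le> card {k\<in>A. y k \<le> t}"
      using that assms by (intro card_mono) auto
    then show ?thesis using that by (simp add: T_def)
  qed
  have value_below: "\<exists>s \<in> T \<inter> y ` A. s \<le> t" if "t \<in> T" for t
  proof -
    let ?B = "{k\<in>A. y k \<le> t}"
    have "card A > 0" using assms by (simp add: card_gt_0_iff)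
    then have "?B \<noteq> {}" using that unfolding T_def by (metis (no_types, lifting) card.empty leD mem_Collect_eq mult_0_right)
    then have M: "Max (y ` ?B) \<in> y ` ?B" "\<And>k. k \<in> ?B \<Longrightarrow> y k \<le> Max (y ` ?B)"
      using assms by auto
    then have "{k\<in>A. y k \<le> Max (y ` ?B)} = ?B" by fastforce
    then show ?thesis using that M(1) by (force simp: T_def)
  qed
  have "Max (y ` A) \<in> T"
  proof -
    have "{k\<in>A. y k \<le> Max (y ` A)} = A" using assms by auto
    then show ?thesis by (simp add: T_def)
  qed
  then have "T \<inter> y ` A \<noteq> {}" using value_below by blast
  then have m: "m \<in> T" "\<And>s. s \<in> T \<inter> y ` A \<Longrightarrow> m \<le> s"
    using assms Min_in[of "T \<inter> y ` A"] by (auto simp: m_def)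
  have "T = {m..}"
  proof (intro equalityI subsetI)
    fix t assume "t \<in> T"
    then show "t \<in> {m..}" using value_below[of t] m(2) by fastforce
  qed (use up[OF m(1)] in simp)
  moreover from this have "lower_median A y = m"
    by (simp add: lower_median_def flip: T_def)
  ultimately show ?thesis by (auto simp: T_def)
qed

text \<open>A number strictly between the two medians in the wrong order would leave fewer than half
  of the values on either side of it.\<close>

lemma lower_median_le_upper_median:
  assumes "finite A" "A \<noteq> {}"
  shows "lower_median A y \<le> - lower_median A (\<lambda>k. - y k)"
proof (rule ccontr)
  assume "\<not> ?thesis"
  then obtain t where t: "- lower_median A (\<lambda>k. - y k) < t" "t < lower_median A y"
    using dense by (metis not_le)
  have "2 * card {k\<in>A. y k \<le> t} < card A"
    using lower_median_le_iff[OF assms, of y t] t by linarith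
  moreover have "2 * card {k\<in>A. - y k \<le> - t} < card A"
    using lower_median_le_iff[OF assms, of "\<lambda>k. - y k" "- t"] t by linarith
  moreover have "card A \<le> card {k\<in>A. y k \<le> t} + card {k\<in>A. - y k \<le> - t}"
    by (rule order_trans[OF card_mono card_Un_le]) (use assms in auto)
  ultimately show False by linarith
qed

text \<open>The midpoint median does not exceed the upper median, which has this property. The bound
  for the values below the midpoint median is the case of negated data.\<close>

lemma half_ge_mid_median:
  assumes "finite A" "A \<noteq> {}"
  shows "card A \<le> 2 * card {k\<in>A. mid_median A y \<le> y k}"
proof -
  have "lower_median A (\<lambda>k. - y k) \<le> - mid_median A y"
    using lower_median_le_upper_median[OF assms, of y] by (simp add: mid_median_def field_simps)
  then show ?thesis
    using lower_median_le_iff[OF assms, of "\<lambda>k. - y k" "- mid_median A y"] by simp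
qed

text \<open>The lower median is monotone and commutes with translations, hence is 1-Lipschitz in the
  maximum norm; continuity follows.\<close>

lemma lower_median_le_of_near:
  assumes "finite A" "A \<noteq> {}" "\<And>k. k \<in> A \<Longrightarrow> z k \<le> y k + e"
  shows "lower_median A z \<le> lower_median A y + e"
proof -
  have "card A \<le> 2 * card {k\<in>A. y k \<le> lower_median A y}"
    using lower_median_le_iff[OF assms(1,2), of y "lower_median A y"] by simp
  also have "card {k\<in>A. y k \<le> lower_median A y} \<le> card {k\<in>A. z k \<le> lower_median A y + e}"
    using assms by (intro card_mono) force+
  finally show ?thesis
    by (simp add: lower_median_le_iff[OF assms(1,2)])
qed

lemma tendsto_lower_median:
  assumes "finite A" "A \<noteq> {}" and lim: "\<And>k. k \<in> A \<Longrightarrow> ((\<lambda>w. y w k) \<longlongrightarrow> z k) F"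
  shows "((\<lambda>w. lower_median A (y w)) \<longlongrightarrow> lower_median A z) F"
proof (rule tendstoI)
  fix e :: real assume "e > 0"
  then have "\<forall>\<^sub>F w in F. \<forall>k\<in>A. dist (y w k) (z k) < e / 2"
    using tendstoD[OF lim, of _ "e / 2"] assms(1) by (simp add: eventually_ball_finite_distrib)
  then show "\<forall>\<^sub>F w in F. dist (lower_median A (y w)) (lower_median A z) < e"
  proof eventually_elim
    case (elim w)
    have near: "y w k \<le> z k + e / 2" "z k \<le> y w k + e / 2" if "k \<in> A" for k
      using bspec[OF elim that] unfolding dist_real_def by linarith+
    have "lower_median A (y w) \<le> lower_median A z + e / 2"
      by (rule lower_median_le_of_near[OF assms(1,2) near(1)])
    moreover have "lower_median A z \<le> lower_median A (y w) + e / 2"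
      by (rule lower_median_le_of_near[OF assms(1,2) near(2)])
    ultimately show ?case using \<open>e > 0\<close> by (simp add: dist_real_def)
  qed
qed

lemma tendsto_mid_median:
  assumes "finite A" "A \<noteq> {}" "\<And>k. k \<in> A \<Longrightarrow> ((\<lambda>w. y w k) \<longlongrightarrow> z k) F"
  shows "((\<lambda>w. mid_median A (y w)) \<longlongrightarrow> mid_median A z) F"
  unfolding mid_median_def
  by (intro tendsto_intros tendsto_lower_median assms) simp_all

text \<open>Whether a given entry is the median depends only on how the other values compare with it;
  the next lemma draws this conclusion.\<close>

lemma lower_median_eq_iff:
  assumes "finite A" "k \<in> A"
  shows "lower_median A y = y k \<longleftrightarrow>
    card A \<le> 2 * card {i\<in>A. y i \<le> y k} \<and> 2 * card {i\<in>A. y i < y k} < card A"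
    (is "?L \<longleftrightarrow> ?le \<and> ?lt")
proof -
  have ne: "A \<noteq> {}" using assms by auto
  note iff = lower_median_le_iff[OF assms(1) ne]
  let ?B = "{i\<in>A. y i < y k}"
  show ?thesis
  proof (intro iffI conjI)
    assume L: ?L
    then show ?le using iff[of y "y k"] by simp
    show ?lt
    proof (rule ccontr)
      assume ge: "\<not> ?lt"
      have "card A > 0" using assms(1) ne by (simp add: card_gt_0_iff)
      then have "?B \<noteq> {}" using ge by (metis card.empty mult_0_right)
      then have M: "Max (y ` ?B) \<in> y ` ?B" "\<And>i. i \<in> ?B \<Longrightarrow> y i \<le> Max (y ` ?B)"
        using assms by auto
      then have "{i\<in>A. y i \<le> Max (y ` ?B)} = ?B" by fastforce
      then have "lower_median A y \<le> Max (y ` ?B)" using ge by (simp add: iff)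
      then show False using M(1) L by auto
    qed
  next
    assume R: "?le \<and> ?lt"
    then have "lower_median A y \<le> y k" by (simp add: iff)
    moreover have False if "lower_median A y < y k"
    proof -
      have "card A \<le> 2 * card {i\<in>A. y i \<le> lower_median A y}"
        using iff[of y "lower_median A y"] by simp
      also have "card {i\<in>A. y i \<le> lower_median A y} \<le> card ?B"
        using that assms by (intro card_mono) auto
      finally show False using R by simp
    qed
    ultimately show ?L by fastforce
  qed
qed

lemma lower_median_eq_transfer:
  assumes "finite A" "k \<in> A" "lower_median A y = y k"
    and "\<And>i. i \<in> A \<Longrightarrow> y i \<le> y k \<longleftrightarrow> z i \<le> z k"
    and "\<And>i. i \<in> A \<Longrightarrow> y i < y k \<longleftrightarrow> z i < z k"
  shows "lower_median A z = z k"
proof -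
  have "{i\<in>A. y i \<le> y k} = {i\<in>A. z i \<le> z k}" "{i\<in>A. y i < y k} = {i\<in>A. z i < z k}"
    using assms(4,5) by auto
  then show ?thesis
    using assms(1-3) by (simp add: lower_median_eq_iff)
qed

text \<open>No value lies strictly between the lower and the upper median, since at least half of
  the values lie on either side of this gap. So if the midpoint is itself a value, the gap
  is empty and the two medians agree.\<close>

lemma lower_median_eq_of_mid_median_eq:
  assumes "finite A" "k \<in> A" "mid_median A y = y k"
  shows "lower_median A y = y k"
proof (rule ccontr)
  assume neq: "lower_median A y \<noteq> y k"
  have ne: "A \<noteq> {}" using assms by auto
  note iff = lower_median_le_iff[OF assms(1) ne]
  define l where "l = lower_median A y"
  define u where "u = - lower_median A (\<lambda>k. - y k)"
  have "l \<le> u" unfolding l_def u_def by (rule lower_median_le_upper_median[OF assms(1) ne])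
  moreover have "y k = (l + u) / 2"
    using assms(3) by (simp add: mid_median_def l_def u_def)
  ultimately have k: "l < y k" "y k < u" using neq by (auto simp: l_def)
  let ?L = "{i\<in>A. y i \<le> l}" and ?U = "{i\<in>A. u \<le> y i}"
  have "card A \<le> 2 * card ?L"
    using iff[of y l] by (simp add: l_def)
  moreover have "card A \<le> 2 * card ?U"
    using iff[of "\<lambda>k. - y k" "- u"] by (simp add: u_def minus_le_iff)
  moreover have "card ?L + card ?U = card (?L \<union> ?U)"
    using assms(1) k by (intro card_Un_disjoint[symmetric]) auto
  moreover have "card (?L \<union> ?U) < card A"
  proof (rule psubset_card_mono[OF assms(1)])
    have "k \<notin> ?L \<union> ?U" using k by simp
    then show "?L \<union> ?U \<subset> A" using assms(2) by blast
  qed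
  ultimately show False by linarith
qed

text \<open>A small perturbation of distinct values keeps their order, and hence keeps the index
  of the median.\<close>

lemma eventually_mid_median_eq:
  assumes "finite A" "k \<in> A" "inj_on z A" "mid_median A z = z k"
    and lim: "\<And>i. i \<in> A \<Longrightarrow> ((\<lambda>w. y w i) \<longlongrightarrow> z i) F"
  shows "\<forall>\<^sub>F w in F. mid_median A (y w) = y w k"
proof -
  have order: "\<forall>\<^sub>F w in F. (z i \<le> z k \<longleftrightarrow> y w i \<le> y w k) \<and> (z i < z k \<longleftrightarrow> y w i < y w k)"
    if "i \<in> A" for i
  proof -
    have d: "((\<lambda>w. y w i - y w k) \<longlongrightarrow> z i - z k) F"
      using that assms(2) by (intro tendsto_diff lim)
    show ?thesis
    proof (cases "z i" "z k" rule: linorder_cases)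
      case less
      then show ?thesis using order_tendstoD(2)[OF d, of 0] by (auto elim!: eventually_mono)
    next
      case equal
      then have "i = k" using inj_onD[OF assms(3)] that assms(2) by blast
      then show ?thesis by simp
    next
      case greater
      then show ?thesis using order_tendstoD(1)[OF d, of 0] by (auto elim!: eventually_mono)
    qed
  qed
  have low: "lower_median A z = z k"
    using assms(1,2,4) by (rule lower_median_eq_of_mid_median_eq)
  have high: "lower_median A (\<lambda>i. - z i) = - z k"
    using assms(1,2,4) by (intro lower_median_eq_of_mid_median_eq) (auto simp: mid_median_uminus)
  have "\<forall>\<^sub>F w in F. \<forall>i\<in>A. (z i \<le> z k \<longleftrightarrow> y w i \<le> y w k) \<and> (z i < z k \<longleftrightarrow> y w i < y w k)"
    using order assms(1) by (simp add: eventually_ball_finite_distrib)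
  then show ?thesis
  proof eventually_elim
    case (elim w)
    have "lower_median A (y w) = y w k"
      by (rule lower_median_eq_transfer[OF assms(1,2) low]) (use elim in auto)
    \<comment> \<open>the same for the upper median, by negating the data\<close>
    moreover have "lower_median A (\<lambda>i. - y w i) = - y w k"
    proof (rule lower_median_eq_transfer[OF assms(1,2) high])
      fix i assume "i \<in> A"
      then show "- z i \<le> - z k \<longleftrightarrow> - y w i \<le> - y w k" "- z i < - z k \<longleftrightarrow> - y w i < - y w k"
        using elim unfolding neg_le_iff_le neg_less_iff_less by (metis not_le)+
    qed
    ultimately show ?case by (simp add: mid_median_def)
  qed
qed

section \<open>The points beyond the median line\<close>

definition upper_half :: "'a set \<Rightarrow> ('a \<Rightarrow> 'b::real_inner) \<Rightarrow> 'b \<Rightarrow> 'a set" where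
  "upper_half A x v = {k\<in>A. mid_median A (\<lambda>k. v \<bullet> x k) \<le> v \<bullet> x k}"

lemma upper_half_uminus:
  "upper_half A x (- v) = {k\<in>A. v \<bullet> x k \<le> mid_median A (\<lambda>k. v \<bullet> x k)}"
  by (simp add: upper_half_def mid_median_uminus)

lemma upper_half_cover: "A \<subseteq> upper_half A x v \<union> upper_half A x (- v)"
  unfolding upper_half_uminus by (auto simp: upper_half_def)

text \<open>A point strictly outside the closed half-space stays outside under a small change of
  direction.\<close>

lemma eventually_upper_half_subset:
  assumes "finite A"
  shows "\<forall>\<^sub>F w in nhds v. upper_half A x w \<subseteq> upper_half A x v"
proof (cases "A = {}")
  case False
  have "\<forall>\<^sub>F w in nhds v. k \<notin> upper_half A x w" if k: "k \<in> A - upper_half A x v" for k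
  proof -
    have "((\<lambda>w. w \<bullet> x k - mid_median A (\<lambda>k. w \<bullet> x k)) \<longlongrightarrow>
        v \<bullet> x k - mid_median A (\<lambda>k. v \<bullet> x k)) (nhds v)"
      using assms False by (intro tendsto_intros tendsto_mid_median filterlim_ident)
    moreover have "v \<bullet> x k - mid_median A (\<lambda>k. v \<bullet> x k) < 0"
      using k by (auto simp: upper_half_def)
    ultimately show ?thesis
      by (rule eventually_mono[OF order_tendstoD(2)]) (auto simp: upper_half_def)
  qed
  then have "\<forall>\<^sub>F w in nhds v. \<forall>k \<in> A - upper_half A x v. k \<notin> upper_half A x w"
    using assms by (simp add: eventually_ball_finite_distrib)
  then show ?thesis
    by eventually_elim (auto simp: upper_half_def)
qed (simp add: upper_half_def)

text \<open>A point on the boundary could leave the half-space in general. If the projections are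
  distinct, it is the median point, and remains the median point for all nearby directions.\<close>

lemma eventually_upper_half_superset:
  assumes "finite A" "inj_on (\<lambda>k. v \<bullet> x k) A"
  shows "\<forall>\<^sub>F w in nhds v. upper_half A x v \<subseteq> upper_half A x w"
proof -
  have "\<forall>\<^sub>F w in nhds v. k \<in> upper_half A x w" if k: "k \<in> upper_half A x v" for k
  proof -
    have kA: "k \<in> A" using k by (simp add: upper_half_def)
    have lim: "((\<lambda>w. w \<bullet> x i) \<longlongrightarrow> v \<bullet> x i) (nhds v)" for i
      by (intro tendsto_intros filterlim_ident)
    show ?thesis
    proof (cases "mid_median A (\<lambda>k. v \<bullet> x k) = v \<bullet> x k")
      case True
      have "\<forall>\<^sub>F w in nhds v. mid_median A (\<lambda>k. w \<bullet> x k) = w \<bullet> x k"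
        by (rule eventually_mid_median_eq[OF assms(1) kA assms(2) True lim])
      then show ?thesis by eventually_elim (simp add: upper_half_def kA)
    next
      case False
      have "((\<lambda>w. w \<bullet> x k - mid_median A (\<lambda>k. w \<bullet> x k)) \<longlongrightarrow>
          v \<bullet> x k - mid_median A (\<lambda>k. v \<bullet> x k)) (nhds v)"
        using assms(1) kA by (intro tendsto_diff tendsto_mid_median lim) auto
      moreover have "0 < v \<bullet> x k - mid_median A (\<lambda>k. v \<bullet> x k)"
        using k False by (auto simp: upper_half_def)
      ultimately show ?thesis
        by (rule eventually_mono[OF order_tendstoD(1)]) (auto simp: upper_half_def kA)
    qed
  qed
  moreover have "finite (upper_half A x v)" using assms(1) by (simp add: upper_half_def)
  ultimately show ?thesis
    by (simp add: eventually_ball_finite_distrib subset_eq)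
qed

section \<open>Quarter turns of the plane\<close>

definition quarter_turn :: "real^2 \<Rightarrow> real^2" where
  "quarter_turn v = vector [- v $ 2, v $ 1]"

lemma quarter_turn_nth [simp]: "quarter_turn v $ 1 = - v $ 2" "quarter_turn v $ 2 = v $ 1"
  by (simp_all add: quarter_turn_def)

lemma quarter_turn_twice [simp]: "quarter_turn (quarter_turn v) = - v"
  by (simp add: vec_eq_iff forall_2)

lemma quarter_turn_uminus [simp]: "quarter_turn (- v) = - quarter_turn v"
  by (simp add: vec_eq_iff forall_2)

lemma norm_quarter_turn [simp]: "norm (quarter_turn v) = norm v"
  by (simp add: norm_vec_def L2_set_def sum_2 add.commute)

lemma continuous_quarter_turn: "isCont quarter_turn v"
proof -
  have "linear quarter_turn"
    by (rule linearI) (simp_all add: vec_eq_iff forall_2)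
  then show ?thesis
    by (simp add: linear_continuous_at linear_conv_bounded_linear)
qed

text \<open>The second row of a frame is thus determined by the first up to sign, and a unit vector
  whose projection identifies two points is a quarter turn of the direction joining them.\<close>

lemma orthogonal_unit_eq_quarter_turn:
  assumes "norm v = 1" "norm w = 1" "v \<bullet> w = 0"
  shows "w = quarter_turn v \<or> w = - quarter_turn v"
proof -
  have v: "v$1 * v$1 + v$2 * v$2 = 1" and w: "w$1 * w$1 + w$2 * w$2 = 1"
    and o: "v$1 * w$1 + v$2 * w$2 = 0"
    using assms by (auto simp: norm_eq_1 inner_vec_def sum_2)
  \<comment> \<open>the determinant of \<open>v\<close> and \<open>w\<close>, which turns out to be the sign sought\<close>
  define s where "s = v$1 * w$2 - v$2 * w$1"
  have w1: "w$1 = s * (- v$2)" and w2: "w$2 = s * v$1"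
    using v o unfolding s_def by algebra+
  have "s * s = 1" using v w unfolding w1 w2 by algebra
  then have "s = 1 \<or> s = -1" by algebra
  then show ?thesis using w1 w2 by (auto simp: vec_eq_iff forall_2)
qed

section \<open>Balanced frames\<close>

text \<open>One quadrant suffices in the definition: the other three quadrants of the frame are
  obtained by replacing \<open>v\<close> with its successive quarter turns.\<close>

definition heavy :: "'a set \<Rightarrow> ('a \<Rightarrow> real^2) \<Rightarrow> real^2 \<Rightarrow> bool" where
  "heavy A x v \<longleftrightarrow>
    card A \<le> 4 * card (upper_half A x v \<inter> upper_half A x (quarter_turn v))"

definition balanced :: "'a set \<Rightarrow> ('a \<Rightarrow> real^2) \<Rightarrow> real^2 \<Rightarrow> bool" where
  "balanced A x v \<longleftrightarrow> heavy A x v \<and> heavy A x (quarter_turn v) \<and>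
    heavy A x (- v) \<and> heavy A x (- quarter_turn v)"

lemma balanced_uminus [simp]: "balanced A x (- v) = balanced A x v"
  by (auto simp: balanced_def)

lemma balanced_quarter_turn [simp]: "balanced A x (quarter_turn v) = balanced A x v"
  by (auto simp: balanced_def)

text \<open>A light quadrant and either of its neighbours cover a half-plane with at least half
  of the points, so both neighbours are heavy.\<close>

lemma heavy_neighbour:
  assumes "finite A" "\<not> heavy A x v"
  shows "heavy A x (quarter_turn v)" "heavy A x (- quarter_turn v)"
proof -
  let ?u = "upper_half A x"
  have A: "A \<noteq> {}" using assms by (auto simp: heavy_def)
  have half: "card A \<le> 2 * card (?u w)" for w
    unfolding upper_half_def by (rule half_ge_mid_median[OF assms(1) A])
  have split: "card (?u w) \<le> card (?u w \<inter> ?u w') + card (?u w \<inter> ?u (- w'))" for w w'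
  proof (rule order_trans[OF card_mono card_Un_le])
    show "?u w \<subseteq> ?u w \<inter> ?u w' \<union> ?u w \<inter> ?u (- w')"
      using upper_half_cover[of A x w'] by (auto simp: upper_half_def)
  qed (use assms(1) in \<open>simp add: upper_half_def\<close>)
  show "heavy A x (quarter_turn v)"
    using half[of "quarter_turn v"] split[of "quarter_turn v" v] assms(2)
    by (simp add: heavy_def Int_commute)
  show "heavy A x (- quarter_turn v)"
    using half[of v] split[of v "quarter_turn v"] assms(2)
    by (simp add: heavy_def Int_commute)
qed

lemma eventually_quarter_turn:
  assumes "\<forall>\<^sub>F w in nhds (quarter_turn v). P w"
  shows "\<forall>\<^sub>F w in nhds v. P (quarter_turn w)"
proof -
  have "filterlim quarter_turn (nhds (quarter_turn v)) (nhds v)"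
    using continuous_quarter_turn[of v] by (simp only: isCont_def tendsto_at_iff_tendsto_nhds)
  then show ?thesis using assms by (simp add: filterlim_iff)
qed

text \<open>Quadrants can only lose points under a small change of direction, so the property of
  not being heavy is an open one.\<close>

lemma closed_heavy:
  assumes "finite A"
  shows "closed {v. heavy A x v}"
proof -
  have light: "\<forall>\<^sub>F w in nhds v. \<not> heavy A x w" if "\<not> heavy A x v" for v
    using eventually_upper_half_subset[OF assms, of x v]
      eventually_quarter_turn[OF eventually_upper_half_subset[OF assms, of x "quarter_turn v"]]
  proof eventually_elim
    case (elim w)
    have "card (upper_half A x w \<inter> upper_half A x (quarter_turn w))
        \<le> card (upper_half A x v \<inter> upper_half A x (quarter_turn v))"
      using elim assms by (intro card_mono) (auto simp: upper_half_def)
    then show ?case using that by (simp add: heavy_def)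
  qed
  have "open (- {v. heavy A x v})"
  proof (rule Topological_Spaces.openI)
    fix v assume "v \<in> - {v. heavy A x v}"
    then obtain T where "open T" "v \<in> T" "\<And>w. w \<in> T \<Longrightarrow> \<not> heavy A x w"
      using light[of v] unfolding eventually_nhds by auto
    then show "\<exists>T. open T \<and> v \<in> T \<and> T \<subseteq> - {v. heavy A x v}"
      by (intro exI[of _ T]) auto
  qed
  then show ?thesis by (simp add: closed_def)
qed

lemma closed_heavy_compose:
  assumes "finite A" "\<And>v. isCont f v"
  shows "closed {v. heavy A x (f v)}"
  using continuous_closed_vimage[OF closed_heavy[OF assms(1), of x] assms(2)]
  unfolding vimage_def mem_Collect_eq .

lemma closed_balanced:
  assumes "finite A"
  shows "closed {v. balanced A x v}"
  unfolding balanced_def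
  by (intro closed_Collect_conj closed_heavy_compose[OF assms] continuous_intros
      continuous_quarter_turn)

lemma connected_unit_circle: "connected (sphere (0 :: real^2) 1)"
  by (rule connected_sphere) simp

text \<open>The sets \<open>D\<close> and \<open>E\<close> in the proof collect the directions for which the one or
  the other diagonal pair of quadrants is heavy.\<close>

lemma balanced_exists:
  assumes "finite A"
  shows "\<exists>v \<in> sphere 0 1. balanced A x v"
proof -
  let ?D = "{v. heavy A x v \<and> heavy A x (- v)}"
  let ?E = "{v. heavy A x (quarter_turn v) \<and> heavy A x (- quarter_turn v)}"
  have "closed ?D" "closed ?E"
    by (intro closed_Collect_conj closed_heavy_compose[OF assms] continuous_intros
        continuous_quarter_turn)+
  moreover have cover: "v \<in> ?D \<union> ?E" for v
    using heavy_neighbour[OF assms, of x v] heavy_neighbour[OF assms, of x "- v"] by auto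
  moreover have "?D \<inter> sphere 0 1 \<noteq> {} \<and> ?E \<inter> sphere 0 1 \<noteq> {}"
  proof -
    have v: "(axis 1 1 :: real^2) \<in> sphere 0 1" by simp
    have "quarter_turn w \<in> ?E \<inter> sphere 0 1" if "w \<in> ?D \<inter> sphere 0 1" for w
      using that by simp
    moreover have "quarter_turn w \<in> ?D \<inter> sphere 0 1" if "w \<in> ?E \<inter> sphere 0 1" for w
      using that by simp
    ultimately show ?thesis using v cover by blast
  qed
  ultimately have "?D \<inter> ?E \<inter> sphere 0 1 \<noteq> {}"
    using connected_closedD[OF connected_unit_circle, of ?D ?E] by blast
  then show ?thesis by (auto simp: balanced_def)
qed

lemma eventually_heavy:
  assumes "finite A" "heavy A x v"
    and "inj_on (\<lambda>k. v \<bullet> x k) A" "inj_on (\<lambda>k. quarter_turn v \<bullet> x k) A"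
  shows "\<forall>\<^sub>F w in nhds v. heavy A x w"
  using eventually_upper_half_superset[OF assms(1,3)]
    eventually_quarter_turn[OF eventually_upper_half_superset[OF assms(1,4)]]
proof eventually_elim
  case (elim w)
  have "card (upper_half A x v \<inter> upper_half A x (quarter_turn v))
      \<le> card (upper_half A x w \<inter> upper_half A x (quarter_turn w))"
    using elim assms by (intro card_mono) (auto simp: upper_half_def)
  then show ?case using assms(2) by (simp add: heavy_def)
qed

lemma eventually_uminus:
  fixes v :: "'a::real_normed_vector"
  assumes "\<forall>\<^sub>F w in nhds (- v). P w"
  shows "\<forall>\<^sub>F w in nhds v. P (- w)"
  using assms tendsto_minus[OF filterlim_ident, of v] by (auto simp: filterlim_iff)

text \<open>Away from the finitely many directions parallel or orthogonal to a join of two points,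
  being balanced is an open condition.\<close>

lemma eventually_balanced:
  assumes "finite A" "balanced A x v"
    and "inj_on (\<lambda>k. v \<bullet> x k) A" "inj_on (\<lambda>k. quarter_turn v \<bullet> x k) A"
  shows "\<forall>\<^sub>F w in nhds v. balanced A x w"
proof -
  have ev: "\<forall>\<^sub>F w in nhds u. heavy A x w"
    if "u \<in> {v, quarter_turn v, - v, - quarter_turn v}" for u
    using that assms by (intro eventually_heavy) (auto simp: balanced_def inj_on_def)
  show ?thesis
    unfolding balanced_def
    by (intro eventually_conj eventually_quarter_turn[where P = "heavy A x"]
        eventually_quarter_turn[where P = "\<lambda>w. heavy A x (- w)"]
        eventually_uminus[where P = "heavy A x"] ev) simp_all
qed

text \<open>Otherwise, by the previous lemma, the balanced directions would be open and closed in the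
  connected unit circle.\<close>

lemma balanced_through_two_points:
  assumes "finite A" "inj_on x A" "a \<in> A" "b \<in> A" "a \<noteq> b"
  shows "\<exists>i\<in>A. \<exists>j\<in>A. i \<noteq> j \<and> balanced A x ((x j - x i) /\<^sub>R norm (x j - x i))"
proof (rule ccontr)
  assume none: "\<not> ?thesis"
  let ?d = "\<lambda>i j. (x j - x i) /\<^sub>R norm (x j - x i)"
  let ?S = "sphere 0 1 \<inter> {v. balanced A x v}"
  have unit: "norm (?d i j) = 1" if "i \<in> A" "j \<in> A" "i \<noteq> j" for i j
  proof -
    have "x j - x i \<noteq> 0" using that inj_onD[OF assms(2), of i j] by auto
    then show ?thesis by simp
  qed
  have inj: "inj_on (\<lambda>k. v \<bullet> x k) A" if "norm v = 1" "balanced A x v" for v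
  proof (rule inj_onI, rule ccontr)
    fix i j assume ij: "i \<in> A" "j \<in> A" "i \<noteq> j" "v \<bullet> x i = v \<bullet> x j"
    \<comment> \<open>\<open>v\<close> is orthogonal to the join, which is then a quarter turn of \<open>v\<close> and balanced like \<open>v\<close>\<close>
    then have "?d i j = quarter_turn v \<or> ?d i j = - quarter_turn v"
      by (intro orthogonal_unit_eq_quarter_turn that unit) (auto simp: inner_diff_right)
    then have "balanced A x (?d i j)" using that(2) by auto
    then show False using none ij by blast
  qed
  have "openin (top_of_set (sphere 0 1)) ?S"
  proof -
    have "\<forall>\<^sub>F w in nhds v. balanced A x w" if "v \<in> ?S" for v
      using that by (intro eventually_balanced assms inj) auto
    then have "?S \<subseteq> interior {v. balanced A x v}"
      by (fastforce simp: interior_def eventually_nhds)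
    then have "?S = sphere 0 1 \<inter> interior {v. balanced A x v}"
      using interior_subset[of "{v. balanced A x v}"] by blast
    then show ?thesis using openin_open_Int[OF open_interior] by simp
  qed
  moreover have "closedin (top_of_set (sphere 0 1)) ?S"
    by (rule closedin_closed_Int[OF closed_balanced[OF assms(1)]])
  moreover have "?S \<noteq> {}" using balanced_exists[OF assms(1)] by blast
  ultimately have "?S = sphere 0 1"
    using connected_unit_circle[unfolded connected_clopen, rule_format, of ?S] by simp
  moreover have "?d a b \<in> sphere 0 1" using unit[of a b] assms by simp
  ultimately show False using none assms by blast
qed

section \<open>Translation to the empirical measure\<close>

lemma matrix_vector_mult_nth_row: "(U *v z) $ i = row i U \<bullet> z"
  for U :: "real^'n^'m"
  by (simp add: matrix_vector_mult_def row_def inner_vec_def)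

lemma measure_proj_rotate_empirical:
  assumes "B \<in> sets borel"
  shows "measure (proj_measure (rotate_measure (empirical_measure n x) U) i) B =
    real (card {k\<in>{1..n}. row i U \<bullet> x k \<in> B}) / real n"
proof -
  have m: "(\<lambda>z. U *v z) \<in> borel_measurable borel"
    by (intro borel_measurable_continuous_onI linear_continuous_on matrix_vector_mul_bounded_linear)
  have m': "(\<lambda>z :: real^2. z $ i) \<in> borel_measurable borel"
    by (intro borel_measurable_continuous_onI continuous_intros)
  have meas: "(\<lambda>z. row i U \<bullet> z) -` B \<in> sets borel"
    using measurable_sets[OF measurable_compose[OF m m'] assms] by (simp add: matrix_vector_mult_nth_row)
  have "measure (proj_measure (rotate_measure (empirical_measure n x) U) i) B =
      measure (empirical_measure n x) ((\<lambda>z. row i U \<bullet> z) -` B)"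
    using m m' assms measurable_sets[OF m' assms]
    by (simp add: proj_measure_def rotate_measure_def measure_distr matrix_vector_mult_nth_row vimage_comp comp_def)
  also have "\<dots> = real (card {k\<in>{1..n}. row i U \<bullet> x k \<in> B}) / real n"
    using measure_empirical_measure[OF meas, of n x] by simp
  finally show ?thesis .
qed

lemma med_mid_empirical:
  assumes "n \<ge> 1"
  shows "med_mid (proj_measure (rotate_measure (empirical_measure n x) U) i) =
    mid_median {1..n} (\<lambda>k. row i U \<bullet> x k)"
proof -
  let ?Q = "proj_measure (rotate_measure (empirical_measure n x) U) i"
  let ?y = "\<lambda>k. row i U \<bullet> x k"
  have half: "1 / 2 \<le> real c / real n \<longleftrightarrow> n \<le> 2 * c" for c
    using assms by (simp add: field_simps flip: of_nat_mult) linarith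
  have le: "1 / 2 \<le> measure ?Q {..t} \<longleftrightarrow> n \<le> 2 * card {k\<in>{1..n}. ?y k \<le> t}" for t
    using measure_proj_rotate_empirical[of "{..t}" n x U i] half by simp
  have ge: "1 / 2 \<le> measure ?Q {t..} \<longleftrightarrow> n \<le> 2 * card {k\<in>{1..n}. t \<le> ?y k}" for t
    using measure_proj_rotate_empirical[of "{t..}" n x U i] half by simp
  have low: "med_lower ?Q = lower_median {1..n} ?y"
    unfolding med_lower_def lower_median_def le by simp
  have "med_upper ?Q = Sup {t. n \<le> 2 * card {k\<in>{1..n}. t \<le> ?y k}}"
    unfolding med_upper_def ge ..
  also have "\<dots> = Sup (uminus ` {t. n \<le> 2 * card {k\<in>{1..n}. - ?y k \<le> t}})"
  proof (rule arg_cong[where f = Sup], intro equalityI subsetI)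
    fix t assume "t \<in> {t. n \<le> 2 * card {k\<in>{1..n}. t \<le> ?y k}}"
    then show "t \<in> uminus ` {t. n \<le> 2 * card {k\<in>{1..n}. - ?y k \<le> t}}"
      by (intro image_eqI[of _ _ "- t"]) simp_all
  next
    fix t assume "t \<in> uminus ` {t. n \<le> 2 * card {k\<in>{1..n}. - ?y k \<le> t}}"
    then obtain s where "t = - s" "n \<le> 2 * card {k\<in>{1..n}. - ?y k \<le> s}" by blast
    then show "t \<in> {t. n \<le> 2 * card {k\<in>{1..n}. t \<le> ?y k}}"
      by (simp add: minus_le_iff)
  qed
  also have "\<dots> = - lower_median {1..n} (\<lambda>k. - ?y k)"
    by (simp add: lower_median_def Inf_real_def)
  finally show ?thesis by (simp add: med_mid_def mid_median_def low)
qed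

fun side_sign :: "side \<Rightarrow> real" where
  "side_sign Neg = -1"
| "side_sign Pos = 1"

text \<open>The frame \<open>U\<close> may have either orientation: reversing the sign of its second row
  only permutes the four quadrants.\<close>

lemma solves_quarter_median_if_balanced:
  fixes x :: "nat \<Rightarrow> real^2" and U :: "real^2^2"
  assumes n: "n \<ge> 1" and U: "orthogonal_matrix U" and bal: "balanced {1..n} x (row 1 U)"
    and turn: "row 2 U = quarter_turn (row 1 U) \<or> row 2 U = - quarter_turn (row 1 U)"
    and \<eta>: "\<And>i. \<eta> $ i = mid_median {1..n} (\<lambda>k. row i U \<bullet> x k)"
  shows "solves_quarter_median (empirical_measure n x) (transpose U *v \<eta>, U)"
proof -
  let ?u = "upper_half {1..n} x"
  let ?\<theta> = "transpose U *v \<eta>"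
  have "U *v ?\<theta> = \<eta>"
    using U unfolding matrix_vector_mul_assoc orthogonal_matrix_def by simp
  then have row_\<theta>: "row i U \<bullet> ?\<theta> = mid_median {1..n} (\<lambda>k. row i U \<bullet> x k)" for i
    using \<eta>[of i] matrix_vector_mult_nth_row[of U ?\<theta> i] by simp
  have hs: "x k \<in> halfspace s ?\<theta> (row i U) \<longleftrightarrow> k \<in> ?u (side_sign s *\<^sub>R row i U)"
    if "k \<in> {1..n}" for k s i
    using that row_\<theta>[of i]
    by (cases s) (auto simp: upper_half_uminus inner_diff_right upper_half_def mid_median_uminus)
  have borel: "halfspace s a b \<in> sets borel" for s a b
    by (cases s) (auto intro!: borel_closed closed_Collect_le continuous_intros)
  have "1 / 2 \<le> measure (empirical_measure n x) (halfspace s ?\<theta> (row i U))" for i s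
  proof -
    let ?w = "side_sign s *\<^sub>R row i U"
    have "{k\<in>{1..n}. x k \<in> halfspace s ?\<theta> (row i U)} = ?u ?w"
      using hs[of _ s i] by (auto simp: upper_half_def)
    moreover have "n \<le> 2 * card (?u ?w)"
      using half_ge_mid_median[of "{1..n}" "\<lambda>k. ?w \<bullet> x k"] n by (simp add: upper_half_def)
    ultimately show ?thesis
      using n by (simp add: measure_empirical_measure[OF borel] field_simps)
  qed
  moreover have "1 / 4 \<le> measure (empirical_measure n x) (quadrant s s' ?\<theta> (row 1 U) (row 2 U))"
    for s s'
  proof -
    let ?q = "?u (side_sign s *\<^sub>R row 1 U) \<inter> ?u (side_sign s' *\<^sub>R row 2 U)"
    have "{k\<in>{1..n}. x k \<in> quadrant s s' ?\<theta> (row 1 U) (row 2 U)} = ?q"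
      using hs[of _ s 1] hs[of _ s' 2] by (auto simp: quadrant_def upper_half_def)
    moreover have "n \<le> 4 * card ?q"
      using bal turn unfolding balanced_def heavy_def
      by (cases s; cases s') (auto simp: Int_commute)
    moreover have "quadrant s s' ?\<theta> (row 1 U) (row 2 U) \<in> sets borel"
      unfolding quadrant_def by (intro sets.Int borel)
    ultimately show ?thesis
      using n by (simp add: measure_empirical_measure field_simps)
  qed
  ultimately show ?thesis
    using U by (simp add: solves_quarter_median_def)
qed

theorem theorem7:
  fixes n :: nat and x :: "nat \<Rightarrow> real^2" and b' :: "nat \<Rightarrow> nat \<Rightarrow> real^2"
  assumes "n \<ge> 2"
    and "inj_on x {1..n}"
    and "\<And>i j. 1 \<le> i \<Longrightarrow> i < j \<Longrightarrow> j \<le> n \<Longrightarrow> norm (b' i j) = 1 \<and> pair_dir x i j \<bullet> b' i j = 0"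
  shows "\<exists>p \<in> candidates n x b'. solves_quarter_median (empirical_measure n x) p"
proof -
  have "\<exists>i j. i \<in> {1..n} \<and> j \<in> {1..n} \<and> i \<noteq> j \<and> balanced {1..n} x (pair_dir x i j)"
    using balanced_through_two_points[of "{1..n}" x 1 2] assms(1,2)
    unfolding pair_dir_def by fastforce
  then obtain i0 j0 where ij0: "i0 \<in> {1..n}" "j0 \<in> {1..n}" "i0 \<noteq> j0"
    "balanced {1..n} x (pair_dir x i0 j0)" by blast
  \<comment> \<open>candidates use increasing index pairs; reversing a join changes the direction by a sign only\<close>
  have "pair_dir x j0 i0 = - pair_dir x i0 j0"
    by (simp add: pair_dir_def norm_minus_commute scaleR_diff_right)
  then have "balanced {1..n} x (pair_dir x j0 i0)" using ij0(4) by simp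
  then have "\<exists>i j. 1 \<le> i \<and> i < j \<and> j \<le> n \<and> balanced {1..n} x (pair_dir x i j)"
    using ij0 by (cases i0 j0 rule: linorder_cases) auto
  then obtain i j where ij: "1 \<le> i" "i < j" "j \<le> n" and bal: "balanced {1..n} x (pair_dir x i j)"
    by blast
  define U where "U = pair_frame x b' i j"
  define \<eta> :: "real^2" where "\<eta> = (\<chi> i. mid_median {1..n} (\<lambda>k. row i U \<bullet> x k))"
  have neq: "x i \<noteq> x j" using ij assms(2) by (auto dest: inj_onD)
  have b': "norm (b' i j) = 1" "pair_dir x i j \<bullet> b' i j = 0"
    using assms(3)[OF ij] by auto
  have "\<eta> \<in> med_grid (rotate_measure (empirical_measure n x) U)"
    using assms(1) by (simp add: med_grid_def \<eta>_def med_mid_empirical)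
  then have "(transpose U *v \<eta>, U) \<in> candidates n x b'"
    unfolding candidates_def U_def using ij by blast
  moreover have "solves_quarter_median (empirical_measure n x) (transpose U *v \<eta>, U)"
  proof (rule solves_quarter_median_if_balanced)
    show "orthogonal_matrix U"
      unfolding U_def by (intro orthogonal_matrix_pair_frame neq b')
    show "balanced {1..n} x (row 1 U)" using bal by (simp add: U_def)
    have "norm (pair_dir x i j) = 1" using neq by (simp add: pair_dir_def)
    from orthogonal_unit_eq_quarter_turn[OF this b']
    show "row 2 U = quarter_turn (row 1 U) \<or> row 2 U = - quarter_turn (row 1 U)"
      by (simp add: U_def)
  qed (use assms(1) in \<open>auto simp: \<eta>_def\<close>)
  ultimately show ?thesis by blast
qed

end
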